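(* Let $X$ be a submetrizable topological space, let $Y$ be a functionally Hausdorff, dense-in-itself topological space of countable pseudocharacter ($\psi(Y)=\omega$), and let $f\colon X\to Y$ be a continuous surjective map that is both open and closed. Then $Y$ is submetrizable.
   Context: A topological space $X$ is submetrizable if there is a topology on the set $X$, contained in the topology of $X$, which is metrizable. A space $Y$ is functionally Hausdorff if for any distinct $x,y\in Y$ there is a continuous $h\colon Y\to[0,1]$ with $h(x)=0$ and $h(y)=1$. A space is dense-in-itself if it has no isolated points. Countable pseudocharacter means that every singleton is an intersection of countably many open sets. A map is open (closed) if it sends open sets to open sets (closed sets to closed sets). *)

theory Defs
  imports "HOL-Analysis.Analysis"
begin

definition submetrizable_space :: "'a topology \<Rightarrow> bool" where
  "submetrizable_space X \<longleftrightarrow>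
     (\<exists>T. topspace T = topspace X \<and> (\<forall>U. openin T U \<longrightarrow> openin X U) \<and> metrizable_space T)"

definition functionally_Hausdorff_space :: "'a topology \<Rightarrow> bool" where
  "functionally_Hausdorff_space Y \<longleftrightarrow>
     (\<forall>x \<in> topspace Y. \<forall>y \<in> topspace Y. x \<noteq> y \<longrightarrow>
        (\<exists>h. continuous_map Y (top_of_set {0..1::real}) h \<and> h x = 0 \<and> h y = 1))"

definition dense_in_itself_space :: "'a topology \<Rightarrow> bool" where
  "dense_in_itself_space Y \<longleftrightarrow> (\<forall>y \<in> topspace Y. \<not> openin Y {y})"

definition countable_pseudocharacter_space :: "'a topology \<Rightarrow> bool" where
  "countable_pseudocharacter_space Y \<longleftrightarrow> (\<forall>y \<in> topspace Y. gdelta_in Y {y})"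

end

theory Submission
  imports Defs
begin

text \<open>Fix a metric on \<open>X\<close> with coarser topology. Since no point of \<open>Y\<close> is isolated,
  there is no locally finite sequence of sets in \<open>X\<close> whose interiors all meet one fibre. Hence
  the fibres are totally bounded, and, as \<open>Y\<close> is functionally Hausdorff, closed in the
  metric topology. So the Hausdorff distance between fibres is a metric on \<open>Y\<close>; openness and
  closedness of \<open>f\<close> together with total boundedness make it continuous.\<close>

section \<open>Locally finite closed families and isolated points\<close>

text \<open>The hypothesis counts indices, whereas \<open>locally_finite_in\<close> counts distinct
  sets; the sets meeting \<open>V\<close> are the image under \<open>D\<close> of a finite index
  set.\<close>

lemma closedin_locally_finite_UN:
  assumes "\<And>n. closedin X (D n)"
    and "\<And>x. x \<in> topspace X \<Longrightarrow> \<exists>V. openin X V \<and> x \<in> V \<and> finite {n. D n \<inter> V \<noteq> {}}"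
  shows "closedin X (\<Union>n. D n)"
proof (rule closedin_locally_finite_Union)
  show "locally_finite_in X (range D)"
    unfolding locally_finite_in_def
  proof (intro conjI ballI)
    fix x assume "x \<in> topspace X"
    then obtain V where V: "openin X V" "x \<in> V" "finite {n. D n \<inter> V \<noteq> {}}"
      using assms(2) by blast
    have "{U \<in> range D. U \<inter> V \<noteq> {}} = D ` {n. D n \<inter> V \<noteq> {}}"
      by auto
    then have "finite {U \<in> range D. U \<inter> V \<noteq> {}}"
      using V(3) by simp
    with V(1,2) show "\<exists>V. openin X V \<and> x \<in> V \<and> finite {U \<in> range D. U \<inter> V \<noteq> {}}"
      by (intro exI[of _ V] conjI)
  next
    show "\<Union> (range D) \<subseteq> topspace X"
      using assms(1) by (simp add: UN_least closedin_subset)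
  qed
  show "closedin X S" if "S \<in> range D" for S
    using that assms(1) by (metis rangeE)
qed

text \<open>A point of countable pseudocharacter is the intersection of a decreasing sequence of
  neighbourhoods \<open>U n\<close> with \<open>U n \<subseteq> f ` B n\<close>. The closed sets
  \<open>C n \<inter> f -` (Y - U (n + 1))\<close> then have a closed union whose image is \<open>U 0\<close> minus
  the point, up to points outside \<open>U 0\<close>, so the point would be isolated.\<close>

lemma isolated_if_locally_finite_fibre_neighbourhoods:
  fixes B C :: "nat \<Rightarrow> 'a set"
  assumes cont: "continuous_map X Y f" and om: "open_map X Y f" and cm: "closed_map X Y f"
    and gd: "gdelta_in Y {y}"
    and B: "\<And>n. openin X (B n)" "\<And>n. y \<in> f ` B n" "\<And>n. B n \<subseteq> C n"
    and C: "\<And>n. closedin X (C n)"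
    and lf: "\<And>x. x \<in> topspace X \<Longrightarrow> \<exists>V. openin X V \<and> x \<in> V \<and> finite {n. C n \<inter> V \<noteq> {}}"
  shows "openin Y {y}"
proof -
  have y: "y \<in> topspace Y"
    using gdelta_in_subset[OF gd] by simp
  obtain E :: "nat \<Rightarrow> 'b set"
    where "\<forall>n. closedin Y (E n)" and E_UN: "(\<Union>n. E n) = topspace Y - {y}"
    using gd unfolding gdelta_in_fsigma_in fsigma_in_ascending by blast
  then have E: "closedin Y (E n)" for n
    by simp
  \<comment> \<open>Intersecting over all \<open>i \<le> n\<close> makes \<open>U\<close>
    decreasing; removing \<open>E i\<close> leaves \<open>y\<close> as the only common point,
    because the sets \<open>E i\<close> exhaust the rest of \<open>Y\<close>.\<close>
  define U where "U n = (\<Inter>i\<le>n. f ` B i - E i)" for n :: nat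
  have openU: "openin Y (U n)" for n
    unfolding U_def
  proof (intro openin_INT2 openin_diff)
    show "openin Y (f ` B i)" for i
      using om B(1) by (simp add: open_map_def)
  qed (simp_all add: E)
  have yU: "y \<in> U n" for n
    using B(2) E_UN by (auto simp: U_def)
  define D where "D n = C n \<inter> {x \<in> topspace X. f x \<in> topspace Y - U (Suc n)}" for n
  have "closedin X (\<Union>n. D n)"
  proof (rule closedin_locally_finite_UN)
    show "closedin X (D n)" for n
      unfolding D_def
      using C openU cont by (intro closedin_Int closedin_continuous_map_preimage) auto
    fix x assume "x \<in> topspace X"
    then obtain V where V: "openin X V" "x \<in> V" "finite {n. C n \<inter> V \<noteq> {}}"
      using lf by blast
    have "finite {n. D n \<inter> V \<noteq> {}}"
      by (rule finite_subset[OF _ V(3)]) (auto simp: D_def)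
    with V show "\<exists>V. openin X V \<and> x \<in> V \<and> finite {n. D n \<inter> V \<noteq> {}}"
      by blast
  qed
  then have "closedin Y (f ` (\<Union>n. D n))"
    using cm by (simp add: closed_map_def)
  then have "openin Y (U 0 - f ` (\<Union>n. D n))"
    using openU by blast
  moreover have "U 0 - f ` (\<Union>n. D n) = {y}"
  proof
    show "{y} \<subseteq> U 0 - f ` (\<Union>n. D n)"
      using yU by (auto simp: D_def)
    have "z \<in> f ` (\<Union>n. D n)" if z: "z \<in> U 0" "z \<noteq> y" for z
    proof -
      have zY: "z \<in> topspace Y"
        using z openU openin_subset by blast
      then obtain m where "z \<in> E m"
        using E_UN z by blast
      then have ex: "z \<notin> U m"
        by (auto simp: U_def)
      \<comment> \<open>Since \<open>z\<close> lies in \<open>U 0\<close>, the first stage that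
        loses \<open>z\<close> is a successor \<open>Suc n\<close>. Then \<open>z\<close> in
        \<open>U n\<close> has a preimage in \<open>B n\<close>, hence in \<open>C n\<close>, while
        \<open>z \<notin> U (Suc n)\<close>: this is why \<open>D n\<close> uses the shifted
        index.\<close>
      define k where "k = (LEAST m. z \<notin> U m)"
      have k: "z \<notin> U k" "\<And>j. j < k \<Longrightarrow> z \<in> U j"
        using LeastI[of "\<lambda>m. z \<notin> U m", OF ex] not_less_Least by (auto simp: k_def)
      then obtain n where n: "k = Suc n"
        using z by (cases k) auto
      with k have "z \<in> U n"
        by simp
      then obtain x where "x \<in> B n" "z = f x"
        by (auto simp: U_def)
      then have "x \<in> D n"
        using B(1,3) k(1) n zY openin_subset by (fastforce simp: D_def)
      then show ?thesis
        using \<open>z = f x\<close> by blast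
    qed
    then show "U 0 - f ` (\<Union>n. D n) \<subseteq> {y}"
      by blast
  qed
  ultimately show ?thesis
    by simp
qed

section \<open>Total boundedness and metric closedness of the fibres\<close>

locale open_closed_map_coarser_metric = Metric_space M d
  for M :: "'a set" and d +
  fixes X :: "'a topology" and Y :: "'b topology" and f :: "'a \<Rightarrow> 'b"
  assumes M: "topspace X = M"
    and coarser: "\<And>U. openin mtopology U \<Longrightarrow> openin X U"
    and fH: "functionally_Hausdorff_space Y"
    and dense: "dense_in_itself_space Y"
    and pseudo: "countable_pseudocharacter_space Y"
    and cont: "continuous_map X Y f"
    and surj: "f ` topspace X = topspace Y"
    and om: "open_map X Y f"
    and cm: "closed_map X Y f"
begin

definition fibre :: "'b \<Rightarrow> 'a set" where
  "fibre y = {x \<in> M. f x = y}"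

lemma fibre_subset: "fibre y \<subseteq> M"
  by (auto simp: fibre_def)

lemma fibre_nonempty: "y \<in> topspace Y \<Longrightarrow> fibre y \<noteq> {}"
  unfolding fibre_def surj[symmetric] M by blast

lemma closedin_coarser: "closedin mtopology C \<Longrightarrow> closedin X C"
  using coarser M by (simp add: closedin_def)

text \<open>Common source of contradiction for total boundedness and closedness of fibres: such a
  family would isolate \<open>y\<close> in the dense-in-itself space \<open>Y\<close>.\<close>

lemma no_locally_finite_neighbourhoods:
  fixes B C :: "nat \<Rightarrow> 'a set"
  assumes "y \<in> topspace Y"
    and "\<And>n. openin X (B n)" "\<And>n. fibre y \<inter> B n \<noteq> {}" "\<And>n. B n \<subseteq> C n"
    and "\<And>n. closedin X (C n)"
    and "\<And>x. x \<in> M \<Longrightarrow> \<exists>V. openin X V \<and> x \<in> V \<and> finite {n. C n \<inter> V \<noteq> {}}"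
  shows False
proof -
  have "openin Y {y}"
  proof (rule isolated_if_locally_finite_fibre_neighbourhoods[OF cont om cm, of y B C])
    show "gdelta_in Y {y}"
      using pseudo assms(1) by (simp add: countable_pseudocharacter_space_def)
    show "y \<in> f ` B n" for n
      using assms(3)[of n] by (auto simp: fibre_def)
  qed (fact assms(2,4,5) | use assms(6) M in blast)+
  then show False
    using dense assms(1) by (simp add: dense_in_itself_space_def)
qed

text \<open>Otherwise the fibre contains an infinite \<open>e\<close>-separated sequence, and the
  closed balls of radius \<open>e/4\<close> around its points are locally finite.\<close>

lemma fibre_totally_bounded:
  assumes y: "y \<in> topspace Y"
  shows "mtotally_bounded (fibre y)"
proof (rule ccontr)
  assume "\<not> mtotally_bounded (fibre y)"
  then obtain e where e: "e > 0"
    and net: "\<not> (\<exists>K. finite K \<and> K \<subseteq> fibre y \<and> fibre y \<subseteq> (\<Union>x\<in>K. mball x e))"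
    unfolding mtotally_bounded_def by meson
  \<comment> \<open>Greedy choice: the finitely many earlier points are no \<open>e\<close>-net of
    the fibre, so a further point lies outside all their balls.\<close>
  have "\<exists>s::nat \<Rightarrow> 'a. \<forall>n. s n \<in> fibre y \<and> (\<forall>m<n. e \<le> d (s m) (s n))"
  proof (rule dependent_wf_choice[where R = less_than and
        P = "\<lambda>s n x. x \<in> fibre y \<and> (\<forall>m<n. e \<le> d (s m) x)"])
    fix n :: nat and s :: "nat \<Rightarrow> 'a"
    assume s: "\<And>m. (m, n) \<in> less_than \<Longrightarrow> s m \<in> fibre y \<and> (\<forall>k<m. e \<le> d (s k) (s m))"
    then have "s ` {..<n} \<subseteq> fibre y"
      by auto
    moreover have "finite (s ` {..<n})"
      by simp
    ultimately have "\<not> fibre y \<subseteq> (\<Union>x\<in>s ` {..<n}. mball x e)"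
      using net by meson
    then obtain x where x: "x \<in> fibre y" "x \<notin> (\<Union>x\<in>s ` {..<n}. mball x e)"
      by (meson subsetI)
    have "e \<le> d (s m) x" if "m < n" for m
      using x that s[of m] fibre_subset[of y] by (force simp: not_less)
    then show "\<exists>x. x \<in> fibre y \<and> (\<forall>m<n. e \<le> d (s m) x)"
      using x by blast
  qed auto
  then obtain s :: "nat \<Rightarrow> 'a" where s: "\<And>n. s n \<in> fibre y" "\<And>m n. m < n \<Longrightarrow> e \<le> d (s m) (s n)"
    by blast
  have sM: "s n \<in> M" for n
    using s fibre_subset by blast
  have sep: "m = n" if "d (s m) (s n) < e" for m n
    using s(2)[of m n] s(2)[of n m] that commute[of "s m" "s n"] by (cases m n rule: linorder_cases) auto
  show False
  proof (rule no_locally_finite_neighbourhoods[OF y])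
    show "openin X (mball (s n) (e/4))" for n
      by (simp add: coarser)
    show "closedin X (mcball (s n) (e/4))" for n
      by (simp add: closedin_coarser)
    show "fibre y \<inter> mball (s n) (e/4) \<noteq> {}" for n
      using s(1)[of n] sM[of n] e by (intro ex_in_conv[THEN iffD1] exI[of _ "s n"]) simp
    show "mball (s n) (e/4) \<subseteq> mcball (s n) (e/4)" for n
      by auto
    fix x assume x: "x \<in> M"
    \<comment> \<open>The ball around \<open>x\<close> meets at most one of the closed balls:
      otherwise two centres, each at distance less than \<open>e/2\<close> from \<open>x\<close>,
      would be closer than \<open>e\<close>.\<close>
    have "m = n" if mn: "mcball (s m) (e/4) \<inter> mball x (e/4) \<noteq> {}" "mcball (s n) (e/4) \<inter> mball x (e/4) \<noteq> {}" for m n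
    proof -
      have close: "d (s k) x < e/2" if "mcball (s k) (e/4) \<inter> mball x (e/4) \<noteq> {}" for k
      proof -
        obtain z where "z \<in> M" "d (s k) z \<le> e/4" "d x z < e/4"
          using \<open>mcball (s k) (e/4) \<inter> mball x (e/4) \<noteq> {}\<close> by auto
        then show ?thesis
          using triangle[of "s k" z x] sM x commute[of x z] by simp
      qed
      have "d (s m) (s n) < e"
        using close[OF mn(1)] close[OF mn(2)] triangle[of "s m" x "s n"] sM x commute[of x "s n"] by simp
      then show ?thesis
        by (rule sep)
    qed
    then have "\<exists>m. {n. mcball (s n) (e/4) \<inter> mball x (e/4) \<noteq> {}} \<subseteq> {m}"
      by blast
    then have "finite {n. mcball (s n) (e/4) \<inter> mball x (e/4) \<noteq> {}}"
      using finite_subset by auto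
    then show "\<exists>V. openin X V \<and> x \<in> V \<and> finite {n. mcball (s n) (e/4) \<inter> V \<noteq> {}}"
      using x e by (intro exI[of _ "mball x (e/4)"]) (simp add: coarser)
  qed
qed

text \<open>If points of a fibre converge for the metric to a point \<open>x\<close> outside it, a
  continuous function on \<open>Y\<close> separating \<open>y\<close> from \<open>f x\<close> keeps small
  balls around these points away from \<open>x\<close>, making them locally finite.\<close>

lemma fibre_closed:
  assumes y: "y \<in> topspace Y"
  shows "closedin mtopology (fibre y)"
proof (rule ccontr)
  assume "\<not> closedin mtopology (fibre y)"
  then obtain x where x: "x \<in> M" "x \<notin> fibre y" and nb: "\<And>r. r > 0 \<Longrightarrow> fibre y \<inter> mball x r \<noteq> {}"
    using fibre_subset[of y] unfolding closedin_metric disjnt_def by blast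
  have "\<exists>z. z \<in> fibre y \<and> d x z < inverse (real (Suc n))" for n
    using nb[of "inverse (real (Suc n))"] by auto
  then obtain s where s: "\<And>n. s n \<in> fibre y" "\<And>n. d x (s n) < inverse (real (Suc n))"
    by metis
  have sM: "s n \<in> M" for n
    using s fibre_subset by blast
  have fx: "f x \<in> topspace Y" "f x \<noteq> y"
    using x surj M by (auto simp: fibre_def)
  then obtain h where h: "continuous_map Y (top_of_set {0..1::real}) h" "h y = 0" "h (f x) = 1"
    using fH y unfolding functionally_Hausdorff_space_def by metis
  define g where "g = h \<circ> f"
  have g: "continuous_map X euclideanreal g"
    using continuous_map_compose[OF cont h(1)] by (simp add: g_def continuous_map_in_subtopology)
  have go: "openin X {z \<in> M. g z \<in> S}" if "open S" for S
    using openin_continuous_map_preimage[OF g, of S] that M by simp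
  have gc: "closedin X {z \<in> M. g z \<in> S}" if "closed S" for S
    using closedin_continuous_map_preimage[OF g, of S] that M by simp
  \<comment> \<open>These radii are positive because \<open>s n\<close> lies in the fibre and
    \<open>x\<close> does not, and they tend to 0 with \<open>d x (s n)\<close>, as local finiteness
    away from \<open>x\<close> requires.\<close>
  define r where "r n = d x (s n) / 2" for n
  have r: "r n > 0" for n
    using s(1)[of n] x sM[of n] by (metis r_def half_gt_zero mdist_pos_less)
  \<comment> \<open>As \<open>g\<close> vanishes on the fibre, the cut at \<open>1/2\<close> keeps
    \<open>s n\<close> in \<open>?B n\<close>. As \<open>g x = 1\<close>, the open set where
    \<open>g\<close> exceeds \<open>1/2\<close> contains \<open>x\<close> and misses every
    \<open>?C n\<close>.\<close>
  let ?B = "\<lambda>n. mball (s n) (r n) \<inter> {z \<in> M. g z \<in> {..<1/2}}"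
  let ?C = "\<lambda>n. mcball (s n) (r n) \<inter> {z \<in> M. g z \<in> {..1/2}}"
  show False
  proof (rule no_locally_finite_neighbourhoods[OF y])
    show "openin X (?B n)" for n
      by (intro openin_Int go coarser) auto
    show "closedin X (?C n)" for n
      by (intro closedin_Int gc closedin_coarser) auto
    show "fibre y \<inter> ?B n \<noteq> {}" for n
    proof -
      have "s n \<in> fibre y \<inter> ?B n"
        using s(1)[of n] sM[of n] r[of n] h(2) by (auto simp: g_def fibre_def)
      then show ?thesis by blast
    qed
    show "?B n \<subseteq> ?C n" for n
      by auto
    fix z assume z: "z \<in> M"
    show "\<exists>V. openin X V \<and> z \<in> V \<and> finite {n. ?C n \<inter> V \<noteq> {}}"
    proof (cases "z = x")
      case True
      have "{n. ?C n \<inter> {z \<in> M. g z \<in> {1/2<..}} \<noteq> {}} = {}"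
        by auto
      moreover have "openin X {z \<in> M. g z \<in> {1/2<..}}"
        by (rule go) auto
      ultimately show ?thesis
        using True x h(3) by (intro exI[of _ "{z \<in> M. g z \<in> {1/2<..}}"]) (auto simp: g_def)
    next
      case False
      define \<delta> where "\<delta> = d x z"
      have \<delta>: "\<delta> > 0"
        using False x z by (simp add: \<delta>_def)
      obtain N where N: "inverse (real (Suc N)) < \<delta>/4"
        using reals_Archimedean[of "\<delta>/4"] \<delta> by auto
      \<comment> \<open>For \<open>n \<ge> N\<close> the closed ball around \<open>s n\<close> stays
        within \<open>3\<delta>/8\<close> of \<open>x\<close>, whereas points of
        \<open>mball z (\<delta>/4)\<close> are farther than \<open>3\<delta>/4\<close> from
        \<open>x\<close>.\<close>
      have bound: "n < N" if meets: "?C n \<inter> mball z (\<delta>/4) \<noteq> {}" for n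
      proof (rule ccontr)
        assume "\<not> n < N"
        then have "inverse (real (Suc n)) \<le> inverse (real (Suc N))"
          by (simp add: field_simps)
        then have small: "d x (s n) < \<delta>/4"
          using N s(2)[of n] by linarith
        obtain w where w: "w \<in> M" "d (s n) w \<le> r n" "d z w < \<delta>/4"
          using meets by auto
        have "d x z \<le> d x (s n) + d (s n) w + d w z"
          using triangle[of x "s n" z] triangle[of "s n" w z] x z w(1) sM[of n] by simp
        then show False
          using small w commute[of z w] \<delta> by (simp add: \<delta>_def r_def)
      qed
      have "{n. ?C n \<inter> mball z (\<delta>/4) \<noteq> {}} \<subseteq> {..<N}"
        unfolding lessThan_def by (intro Collect_mono impI bound)
      then have "finite {n. ?C n \<inter> mball z (\<delta>/4) \<noteq> {}}"
        using finite_lessThan by (rule finite_subset)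
      moreover have "openin X (mball z (\<delta>/4))" "z \<in> mball z (\<delta>/4)"
        using z \<delta> by (simp_all add: coarser)
      ultimately show ?thesis
        by (intro exI[of _ "mball z (\<delta>/4)"] conjI)
    qed
  qed
qed

section \<open>Continuous dependence of fibres on the base point\<close>

text \<open>Total boundedness supplies a finite \<open>e/2\<close>-net \<open>K\<close> of the fibre
  over \<open>y\<close>. Openness of \<open>f\<close> lets nearby fibres meet every ball of the net;
  closedness keeps them inside the union of these balls.\<close>

lemma fibres_close:
  assumes y: "y \<in> topspace Y" and e: "e > 0"
  obtains V where "openin Y V" "y \<in> V"
    "\<And>y' x. y' \<in> V \<Longrightarrow> x \<in> fibre y \<Longrightarrow> \<exists>x'\<in>fibre y'. d x x' < e"
    "\<And>y' x'. y' \<in> V \<Longrightarrow> x' \<in> fibre y' \<Longrightarrow> \<exists>x\<in>fibre y. d x x' < e"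
proof -
  obtain K where K: "finite K" "K \<subseteq> fibre y" "fibre y \<subseteq> (\<Union>x\<in>K. mball x (e/2))"
    using fibre_totally_bounded[OF y] e unfolding mtotally_bounded_def by (meson half_gt_zero)
  have KM: "K \<subseteq> M"
    using K fibre_subset by blast
  let ?W = "\<Union>x\<in>K. mball x (e/2)"
  \<comment> \<open>The intersection collects the points whose fibres meet each ball; the subtracted
    image consists of those whose fibres leave \<open>?W\<close>.\<close>
  define V where "V = (topspace Y \<inter> (\<Inter>x\<in>K. f ` mball x (e/2))) - f ` (M - ?W)"
  show thesis
  proof
    have "openin Y (f ` mball x (e/2))" for x
      using om coarser by (simp add: open_map_def)
    then have "openin Y (topspace Y \<inter> (\<Inter>x\<in>K. f ` mball x (e/2)))"
      using K(1) by (cases "K = {}") auto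
    moreover have "openin X ?W"
      by (auto intro: coarser)
    then have "closedin Y (f ` (M - ?W))"
      using cm M by (metis closed_map_def closedin_diff closedin_topspace)
    ultimately show "openin Y V"
      unfolding V_def by blast
    show "y \<in> V"
      using K y e KM by (fastforce simp: V_def fibre_def)
  next
    fix y' x assume y': "y' \<in> V" and x: "x \<in> fibre y"
    then obtain k where k: "k \<in> K" "d k x < e/2"
      using K by auto
    then obtain x' where x': "x' \<in> M" "d k x' < e/2" "f x' = y'"
      using y' by (force simp: V_def)
    have "d x x' < e"
      using triangle[of x k x'] k x' KM x fibre_subset[of y] commute[of x k]
      by (smt (verit) field_sum_of_halves subsetD)
    then show "\<exists>x'\<in>fibre y'. d x x' < e"
      using x' by (auto simp: fibre_def)
  next
    fix y' x' assume "y' \<in> V" "x' \<in> fibre y'"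
    then have "x' \<in> M" "f x' \<notin> f ` (M - ?W)"
      by (simp_all add: V_def fibre_def)
    then have "x' \<in> ?W"
      by blast
    then show "\<exists>x\<in>fibre y. d x x' < e"
      using K(2) e by force
  qed
qed

section \<open>Distance to a fibre and the metric on \<open>Y\<close>\<close>

definition infdist_fibre :: "'b \<Rightarrow> 'a \<Rightarrow> real" where
  "infdist_fibre y x = (INF k\<in>fibre y. d x k)"

lemma infdist_fibre_le: "k \<in> fibre y \<Longrightarrow> infdist_fibre y x \<le> d x k"
  unfolding infdist_fibre_def by (intro cINF_lower bdd_belowI[of _ 0]) auto

lemma infdist_fibre_ge:
  "y \<in> topspace Y \<Longrightarrow> (\<And>k. k \<in> fibre y \<Longrightarrow> c \<le> d x k) \<Longrightarrow> c \<le> infdist_fibre y x"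
  unfolding infdist_fibre_def by (intro cINF_greatest fibre_nonempty)

lemma infdist_fibre_le_add:
  assumes "y \<in> topspace Y" "y' \<in> topspace Y" "x \<in> M"
    and "\<And>k. k \<in> fibre y' \<Longrightarrow> \<exists>k'\<in>fibre y. d k k' < e"
  shows "infdist_fibre y x \<le> infdist_fibre y' x + e"
proof -
  have "infdist_fibre y x - e \<le> infdist_fibre y' x"
  proof (rule infdist_fibre_ge[OF assms(2)])
    fix k assume k: "k \<in> fibre y'"
    then obtain k' where k': "k' \<in> fibre y" "d k k' < e"
      using assms(4) by blast
    then show "infdist_fibre y x - e \<le> d x k"
      using infdist_fibre_le[OF k'(1), of x] triangle[of x k k'] k fibre_subset[of y] fibre_subset[of y'] assms(3)
      by (smt (verit) subsetD)
  qed
  then show ?thesis by simp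
qed

text \<open>Vanishing distance forces membership because the fibre is closed in the metric
  topology.\<close>

lemma infdist_fibre_eq_0_iff:
  assumes y: "y \<in> topspace Y" and x: "x \<in> M"
  shows "infdist_fibre y x = 0 \<longleftrightarrow> f x = y"
proof
  assume 0: "infdist_fibre y x = 0"
  show "f x = y"
  proof (rule ccontr)
    assume "f x \<noteq> y"
    then have "x \<in> M - fibre y"
      using x by (auto simp: fibre_def)
    then obtain r where r: "r > 0" "disjnt (fibre y) (mball x r)"
      using fibre_closed[OF y] unfolding closedin_metric by blast
    have "r \<le> infdist_fibre y x"
    proof (rule infdist_fibre_ge[OF y])
      fix k assume "k \<in> fibre y"
      with r x fibre_subset[of y] show "r \<le> d x k"
        by (force simp: disjnt_iff)
    qed
    with 0 r show False by simp
  qed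
next
  assume "f x = y"
  then have "x \<in> fibre y"
    using x by (simp add: fibre_def)
  then have "infdist_fibre y x \<le> 0"
    using infdist_fibre_le[of x y x] x by simp
  moreover have "0 \<le> infdist_fibre y x"
    by (intro infdist_fibre_ge[OF y]) auto
  ultimately show "infdist_fibre y x = 0" by simp
qed

text \<open>This is the Hausdorff distance between the fibres.\<close>

definition fibre_dist :: "'b \<Rightarrow> 'b \<Rightarrow> real" where
  "fibre_dist y y' = (if y \<in> topspace Y \<and> y' \<in> topspace Y
     then SUP x\<in>M. \<bar>infdist_fibre y x - infdist_fibre y' x\<bar> else 0)"

context
  assumes bounded: "\<And>x x'. d x x' \<le> 1"
begin

lemma infdist_fibre_bounds:
  assumes "y \<in> topspace Y"
  shows "0 \<le> infdist_fibre y x" "infdist_fibre y x \<le> 1"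
proof -
  show "0 \<le> infdist_fibre y x"
    by (intro infdist_fibre_ge[OF assms]) auto
  obtain k where "k \<in> fibre y"
    using fibre_nonempty[OF assms] by blast
  then show "infdist_fibre y x \<le> 1"
    using infdist_fibre_le[of k y x] bounded[of x k] by linarith
qed

text \<open>The bound on \<open>d\<close> makes the differences bounded above, so the supremum
  dominates each of them.\<close>

lemma fibre_dist_ge:
  assumes "y \<in> topspace Y" "y' \<in> topspace Y" "x \<in> M"
  shows "\<bar>infdist_fibre y x - infdist_fibre y' x\<bar> \<le> fibre_dist y y'"
proof -
  have "\<bar>infdist_fibre y x - infdist_fibre y' x\<bar> \<le> 1" for x
    using infdist_fibre_bounds[OF assms(1), of x] infdist_fibre_bounds[OF assms(2), of x] by linarith
  then have "bdd_above ((\<lambda>x. \<bar>infdist_fibre y x - infdist_fibre y' x\<bar>) ` M)"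
    by (intro bdd_aboveI[of _ 1]) auto
  then show ?thesis
    using assms by (auto simp: fibre_dist_def intro: cSUP_upper2)
qed

lemma fibre_dist_le:
  assumes "y \<in> topspace Y" "y' \<in> topspace Y"
    and "\<And>x. x \<in> M \<Longrightarrow> \<bar>infdist_fibre y x - infdist_fibre y' x\<bar> \<le> c"
  shows "fibre_dist y y' \<le> c"
proof -
  have "M \<noteq> {}"
    using assms(1) surj M by auto
  then show ?thesis
    using assms by (auto simp: fibre_dist_def intro!: cSUP_least)
qed

text \<open>Distinct points are separated by evaluating both distance functions at a point of one
  fibre: only one of them vanishes there.\<close>

lemma Metric_space_fibre_dist: "Metric_space (topspace Y) fibre_dist"
proof
  have pt: "\<exists>x\<in>M. f x = y" if "y \<in> topspace Y" for y
    using that surj M by (metis imageE)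
  fix y y' :: 'b
  \<comment> \<open>\<open>Metric_space\<close> demands nonnegativity and symmetry also outside the
    carrier; the default value 0 provides them.\<close>
  show "0 \<le> fibre_dist y y'"
  proof (cases "y \<in> topspace Y \<and> y' \<in> topspace Y")
    case True
    then obtain x where "x \<in> M"
      using pt by blast
    with True show ?thesis
      using fibre_dist_ge[of y y' x] by linarith
  qed (auto simp: fibre_dist_def)
  show "fibre_dist y y' = fibre_dist y' y"
    by (simp add: fibre_dist_def abs_minus_commute conj_commute)
  show "fibre_dist y y' = 0 \<longleftrightarrow> y = y'" if Y: "y \<in> topspace Y" "y' \<in> topspace Y"
  proof
    assume 0: "fibre_dist y y' = 0"
    obtain x where x: "x \<in> M" "f x = y"
      using pt Y(1) by blast
    then have "infdist_fibre y x = 0"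
      using infdist_fibre_eq_0_iff Y by simp
    then have "infdist_fibre y' x = 0"
      using fibre_dist_ge[OF Y x(1)] 0 by simp
    then show "y = y'"
      using infdist_fibre_eq_0_iff Y x by simp
  next
    assume "y = y'"
    moreover have "M \<noteq> {}"
      using Y(1) surj M by auto
    ultimately show "fibre_dist y y' = 0"
      by (simp add: fibre_dist_def)
  qed
  fix y''
  assume Y: "y \<in> topspace Y" "y' \<in> topspace Y" "y'' \<in> topspace Y"
  show "fibre_dist y y'' \<le> fibre_dist y y' + fibre_dist y' y''"
  proof (rule fibre_dist_le[OF Y(1,3)])
    fix x assume "x \<in> M"
    then show "\<bar>infdist_fibre y x - infdist_fibre y'' x\<bar> \<le> fibre_dist y y' + fibre_dist y' y''"
      using fibre_dist_ge[OF Y(1,2), of x] fibre_dist_ge[OF Y(2,3), of x] by linarith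
  qed
qed

lemma submetrizable_range: "submetrizable_space Y"
proof -
  interpret F: Metric_space "topspace Y" fibre_dist
    by (rule Metric_space_fibre_dist)
  have "openin Y U" if U: "openin F.mtopology U" for U
  proof (subst openin_subopen, intro ballI)
    fix y assume "y \<in> U"
    then obtain e where e: "e > 0" "F.mball y e \<subseteq> U" and y: "y \<in> topspace Y"
      using U unfolding F.openin_mtopology by blast
    \<comment> \<open>The radius is halved because the supremum preserves only a weak inequality,
      while the open ball needs a strict one.\<close>
    obtain V where V: "openin Y V" "y \<in> V"
      "\<And>y' x. y' \<in> V \<Longrightarrow> x \<in> fibre y \<Longrightarrow> \<exists>x'\<in>fibre y'. d x x' < e/2"
      "\<And>y' x'. y' \<in> V \<Longrightarrow> x' \<in> fibre y' \<Longrightarrow> \<exists>x\<in>fibre y. d x x' < e/2"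
      using fibres_close[OF y, of "e/2"] e by auto
    have "V \<subseteq> F.mball y e"
    proof
      fix y' assume y': "y' \<in> V"
      then have Y': "y' \<in> topspace Y"
        using V(1) openin_subset by blast
      have "fibre_dist y y' \<le> e/2"
      proof (rule fibre_dist_le[OF y Y'])
        fix x assume x: "x \<in> M"
        have "infdist_fibre y x \<le> infdist_fibre y' x + e/2"
          using V(4)[OF y'] by (intro infdist_fibre_le_add[OF y Y' x]) (simp add: commute)
        moreover have "infdist_fibre y' x \<le> infdist_fibre y x + e/2"
          using V(3)[OF y'] by (intro infdist_fibre_le_add[OF Y' y x])
        ultimately show "\<bar>infdist_fibre y x - infdist_fibre y' x\<bar> \<le> e/2"
          by linarith
      qed
      then show "y' \<in> F.mball y e"
        using e y Y' by simp
    qed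
    then show "\<exists>T. openin Y T \<and> y \<in> T \<and> T \<subseteq> U"
      using V(1,2) e(2) by (meson subset_trans)
  qed
  then show ?thesis
    unfolding submetrizable_space_def using F.metrizable_space_mtopology F.topspace_mtopology by blast
qed

end

end

section \<open>Reduction to a bounded metric\<close>

theorem theorem25:
  fixes X :: "'a topology" and Y :: "'b topology" and f :: "'a \<Rightarrow> 'b"
  assumes "submetrizable_space X"
    and "functionally_Hausdorff_space Y"
    and "dense_in_itself_space Y"
    and "countable_pseudocharacter_space Y"
    and "continuous_map X Y f"
    and "f ` topspace X = topspace Y"
    and "open_map X Y f"
    and "closed_map X Y f"
  shows "submetrizable_space Y"
proof -
  obtain M d where m: "Metric_space M d" "topspace X = M"
    and coarser: "\<And>U. openin (Metric_space.mtopology M d) U \<Longrightarrow> openin X U"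
    using assms(1) unfolding submetrizable_space_def metrizable_space_def
    by (metis Metric_space.topspace_mtopology)
  interpret D: Metric_space M d
    by fact
  \<comment> \<open>Capping at 1 keeps the metric topology and supplies the bound under which
    \<open>fibre_dist\<close> is a metric.\<close>
  let ?d = "D.capped_dist 1"
  have "open_closed_map_coarser_metric M ?d X Y f"
    unfolding open_closed_map_coarser_metric_def open_closed_map_coarser_metric_axioms_def
    using D.capped_dist m(2) coarser assms by (simp add: D.mtopology_capped_metric)
  then show ?thesis
    by (rule open_closed_map_coarser_metric.submetrizable_range) (simp add: D.capped_dist_def)
qed

end
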